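(* Let a structural causal model (SCM) be given with treatment variable $X$ (possibly multivariate), outcome variable $Y$, vector of observed variables $O$, and vector $U^C$ of causal exogenous variables (the elements of the causal exogenous set $\mathcal U^C$). Assume that (i) the exogenous variables $U_{V_i}$ are continuous, and the probability density of each exists and is strictly positive for all possible values of $U_{V_i}$; (ii) the SCM is faithful to the graph $\mathcal G^+$, i.e. any independences that hold in the model must hold in the causal graph; (iii) $f_Y$ and the density $p$ are differentiable with respect to $X$ and satisfy sufficient regularity assumptions (all expectations below exist and differentiation in $x$ may be interchanged with integration). Let $$\mathcal B(x,o):=\mathbb E_{U^C\mid x,o}\big[f_Y^{x,\underline o}\,\nabla_x\log p(U^C\mid x,o)\big]$$ be the causal bias. Then $$\mathcal B(x,o)=\mathrm{Cov}_{U^C\mid x,o}\big(f_Y^{x,\underline o},\ \nabla_x\log p(U^C,x,o)\big),$$ where $p(U^C,x,o)$ denotes the joint density of $U^C$, $X$ and $O$ (partially) evaluated at $X=x$, $O=o$.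
   Context: **SCM.** A (canonical) structural causal model consists of mutually independent exogenous random variables $\mathcal U=\{U_{V_1},\dots,U_{V_n}\}$ with densities $p(U_{V_i})$, a DAG $\mathcal G$ on the endogenous variables $\mathcal V=\{V_1,\dots,V_n\}$ (the causal graph), and functions $f_{V_i}$ with $V_i:=f_{V_i}(\mathrm{Pa}(V_i),U_{V_i})$ for all $i$, where $\mathrm{Pa}(V_i)\subset\mathcal V$ are the parents of $V_i$ in $\mathcal G$. The graph $\mathcal G^+$ is the DAG on $\mathcal V\cup\mathcal U$ obtained from $\mathcal G$ by adding an edge $U_{V_i}\to V_i$ for every $i$. $\mathrm{De}(\cdot)$ denotes descendants in $\mathcal G$ and $\mathrm{An}^+(\cdot)$ ancestors in $\mathcal G^+$; a variable is not counted among its own ancestors or descendants. **Observed variables.** $X,Y\in\mathcal V$, $\mathcal X=\{X\}$, $Y$ is scalar, $\mathcal O\subseteq\mathcal V\setminus\{X,Y\}$ is the set of observed variables, $O$ the vector of its elements with realization $o$. $\underline{\mathcal O}:=\mathcal O\setminus\mathrm{De}(X)$, and $\underline o$ is the corresponding sub-vector of $o$. **Independence.** $A\perp\!\!\!\perp B\mid\mathcal C$ is conditional independence; in the causal graph it means that $A$ and $B$ are d-separated by $\mathcal C$ in $\mathcal G^+$ (the two notions agree under the global Markov property and faithfulness). **Causal exogenous set.** $$\mathcal U^C:=\{U_{V_i}\in\mathcal U\cap\mathrm{An}^+(Y):\ U_{V_i}\not\perp\!\!\!\perp Y\mid \mathcal X\cup\underline{\mathcal O}\}.$$ **Partial evaluation.**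 For a structural function $f$ and a set $\mathcal B\subseteq\mathcal V$ with values $b$, $f^{b}=f^{\mathcal B\leftarrow b}$ is $f$ with every argument in $\mathcal B$ set to its value in $b$. Remaining endogenous arguments are resolved recursively through their own structural equations, again with variables of $\mathcal B$ replaced by their assigned values, so that $f^b$ is a function of exogenous variables only. Thus $f_Y^{x,\underline o}$ is $f_Y$ with $X\leftarrow x$ and $\underline{\mathcal O}\leftarrow\underline o$; it depends only on the exogenous variables in $\mathcal U^C$. **Notation.** $\nabla_x h$ is the Jacobian of $h$ with respect to $x$ (a row vector if $h$ is scalar). $\mathbb E_{U^C\mid x,o}$ and $\mathrm{Cov}_{U^C\mid x,o}$ are expectation and covariance with respect to $p(U^C\mid X=x,O=o)$; the covariance of a scalar with a row vector is the row vector of componentwise covariances. Gradients of log-densities in $x$ are taken with $U^C$ and $o$ held fixed. *)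

theory Defs
  imports "HOL-Probability.Probability"
begin

section \<open>Real vectors of varying dimension\<close>

text \<open>
  The variables of a model may have different dimensions, so a vector in Euclidean \<open>n\<close>-space is
  rendered as a function on \<open>{..<n}\<close> that is extensional (\<open>undefined\<close> from \<open>n\<close> on).
  \<open>euclid n\<close> is this space with its Borel sets and Lebesgue measure.
\<close>

type_synonym vec = "nat \<Rightarrow> real"

definition euclid :: "nat \<Rightarrow> vec measure" where
  "euclid n = (\<Pi>\<^sub>M i\<in>{..<n}. lborel)"

text \<open>Frechet differentiability at \<open>x\<close>; \<open>L2_set\<close> is the Euclidean norm of the coordinates.\<close>

definition vec_differentiable :: "nat \<Rightarrow> (vec \<Rightarrow> real) \<Rightarrow> vec \<Rightarrow> bool" where
  "vec_differentiable n h x \<longleftrightarrow>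
     (\<exists>g :: vec. \<forall>\<epsilon>>0. \<exists>\<delta>>0. \<forall>y\<in>space (euclid n).
        L2_set (\<lambda>k. y k - x k) {..<n} < \<delta> \<longrightarrow>
        \<bar>h y - h x - (\<Sum>k<n. g k * (y k - x k))\<bar> \<le> \<epsilon> * L2_set (\<lambda>k. y k - x k) {..<n})"

text \<open>The Jacobian of a scalar function, i.e. the row vector of its partial derivatives.\<close>

definition row_jacobian :: "nat \<Rightarrow> (vec \<Rightarrow> real) \<Rightarrow> vec \<Rightarrow> vec" where
  "row_jacobian n h x = (\<lambda>k\<in>{..<n}. deriv (\<lambda>t. h (x(k := t))) (x k))"

section \<open>d-separation\<close>

text \<open>
  A graph is its edge relation; \<open>(a, b) \<in> E\<close> is the edge from \<open>a\<close> to \<open>b\<close>. In an acyclic graph the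
  transitive closure \<open>E\<^sup>+\<close> is the ancestor relation in which no node is its own ancestor.
\<close>

definition is_path :: "('n \<times> 'n) set \<Rightarrow> 'n list \<Rightarrow> bool" where
  "is_path E ns \<longleftrightarrow> ns \<noteq> [] \<and> distinct ns \<and>
     (\<forall>i. Suc i < length ns \<longrightarrow> (ns ! i, ns ! Suc i) \<in> E \<or> (ns ! Suc i, ns ! i) \<in> E)"

definition blocked :: "('n \<times> 'n) set \<Rightarrow> 'n set \<Rightarrow> 'n list \<Rightarrow> bool" where
  "blocked E C ns \<longleftrightarrow> (\<exists>i. 0 < i \<and> Suc i < length ns \<and>
     (if (ns ! (i - 1), ns ! i) \<in> E \<and> (ns ! Suc i, ns ! i) \<in> E
      then ns ! i \<notin> C \<and> (\<forall>d. (ns ! i, d) \<in> E\<^sup>+ \<longrightarrow> d \<notin> C)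
      else ns ! i \<in> C))"

definition d_separated :: "('n \<times> 'n) set \<Rightarrow> 'n \<Rightarrow> 'n \<Rightarrow> 'n set \<Rightarrow> bool" where
  "d_separated E a b C \<longleftrightarrow>
     (\<forall>ns. is_path E ns \<and> hd ns = a \<and> last ns = b \<longrightarrow> blocked E C ns)"

section \<open>Structural causal models\<close>

text \<open>
  Endogenous variables are named by elements of \<open>'v\<close>; the exogenous variable \<open>U\<^sub>v\<close> belonging to \<open>v\<close>
  is addressed by the same name. \<open>exo_range S v\<close> is the set of possible values of \<open>U\<^sub>v\<close>, and
  \<open>exo_density S v\<close> its density. \<open>func S v pa u\<close> is the structural function \<open>f\<^sub>v\<close> at the parents'
  values \<open>pa\<close> (a function on the parents) and the value \<open>u\<close> of \<open>U\<^sub>v\<close>.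
\<close>

record ('v, 'w) scm =
  endo :: "'v set"
  edges :: "('v \<times> 'v) set"
  endo_dim :: "'v \<Rightarrow> nat"
  exo_dim :: "'v \<Rightarrow> nat"
  func :: "'v \<Rightarrow> ('v \<Rightarrow> vec) \<Rightarrow> vec \<Rightarrow> vec"
  base :: "'w measure"
  exo :: "'v \<Rightarrow> 'w \<Rightarrow> vec"
  exo_range :: "'v \<Rightarrow> vec set"
  exo_density :: "'v \<Rightarrow> vec \<Rightarrow> real"

definition parents :: "('v, 'w) scm \<Rightarrow> 'v \<Rightarrow> 'v set" where
  "parents S v = {w. (w, v) \<in> edges S}"

definition descendants :: "('v, 'w) scm \<Rightarrow> 'v \<Rightarrow> 'v set" where
  "descendants S v = {w. (v, w) \<in> (edges S)\<^sup>+}"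

definition is_scm :: "('v, 'w) scm \<Rightarrow> bool" where
  "is_scm S \<longleftrightarrow>
     finite (endo S) \<and> edges S \<subseteq> endo S \<times> endo S \<and> acyclic (edges S) \<and>
     (\<forall>v\<in>endo S. 0 < endo_dim S v \<and> 0 < exo_dim S v) \<and>
     (\<forall>v\<in>endo S. (\<lambda>(pa, u). func S v pa u) \<in>
        measurable ((\<Pi>\<^sub>M w\<in>parents S v. euclid (endo_dim S w)) \<Otimes>\<^sub>M euclid (exo_dim S v))
                   (euclid (endo_dim S v))) \<and>
     prob_space (base S) \<and>
     prob_space.indep_vars (base S) (\<lambda>v. euclid (exo_dim S v)) (exo S) (endo S) \<and>
     (\<forall>v\<in>endo S. exo_range S v \<in> sets (euclid (exo_dim S v)) \<and>
        (\<forall>w\<in>space (base S). exo S v w \<in> exo_range S v) \<and>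
        (\<forall>u. 0 \<le> exo_density S v u) \<and>
        distributed (base S) (euclid (exo_dim S v)) (exo S v) (\<lambda>u. ennreal (exo_density S v u)))"

subsection \<open>Partial evaluation\<close>

text \<open>
  A partial assignment \<open>b\<close> of values to endogenous variables is a map with domain \<open>\<B>\<close>. \<open>resolve S b u\<close>
  gives all endogenous values when the variables of \<open>\<B>\<close> are set to \<open>b\<close> and the others are computed
  recursively along the edges (a well-founded relation, as the graph is finite and acyclic);
  \<open>partial_eval S b v u\<close> is \<open>f\<^sub>v\<^sup>b\<close> at the exogenous values \<open>u\<close>.
\<close>

definition resolve :: "('v, 'w) scm \<Rightarrow> ('v \<rightharpoonup> vec) \<Rightarrow> ('v \<Rightarrow> vec) \<Rightarrow> 'v \<Rightarrow> vec" where
  "resolve S b u = wfrec (edges S)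
     (\<lambda>val v. case b v of
        Some z \<Rightarrow> z
      | None \<Rightarrow> func S v (restrict val (parents S v)) (u v))"

definition partial_eval :: "('v, 'w) scm \<Rightarrow> ('v \<rightharpoonup> vec) \<Rightarrow> 'v \<Rightarrow> ('v \<Rightarrow> vec) \<Rightarrow> vec" where
  "partial_eval S b v u = func S v (restrict (resolve S b u) (parents S v)) (u v)"

definition endo_rv :: "('v, 'w) scm \<Rightarrow> 'v \<Rightarrow> 'w \<Rightarrow> vec" where
  "endo_rv S v w = resolve S Map.empty (\<lambda>v'. exo S v' w) v"

subsection \<open>The augmented graph and faithfulness\<close>

datatype 'v node = Endo 'v | Exo 'v

definition nodes_plus :: "('v, 'w) scm \<Rightarrow> 'v node set" where
  "nodes_plus S = Endo ` endo S \<union> Exo ` endo S"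

definition edges_plus :: "('v, 'w) scm \<Rightarrow> ('v node \<times> 'v node) set" where
  "edges_plus S = {(Endo a, Endo b) |a b. (a, b) \<in> edges S} \<union> {(Exo v, Endo v) |v. v \<in> endo S}"

fun node_dim :: "('v, 'w) scm \<Rightarrow> 'v node \<Rightarrow> nat" where
  "node_dim S (Endo v) = endo_dim S v"
| "node_dim S (Exo v) = exo_dim S v"

fun node_rv :: "('v, 'w) scm \<Rightarrow> 'v node \<Rightarrow> 'w \<Rightarrow> vec" where
  "node_rv S (Endo v) = endo_rv S v"
| "node_rv S (Exo v) = exo S v"

definition node_sigma :: "('v, 'w) scm \<Rightarrow> 'v node set \<Rightarrow> 'w measure" where
  "node_sigma S C = vimage_algebra (space (base S))
     (\<lambda>w. \<lambda>c\<in>C. node_rv S c w) (\<Pi>\<^sub>M c\<in>C. euclid (node_dim S c))"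

definition cond_independent :: "('v, 'w) scm \<Rightarrow> 'v node \<Rightarrow> 'v node \<Rightarrow> 'v node set \<Rightarrow> bool" where
  "cond_independent S a b C \<longleftrightarrow>
     (\<forall>A\<in>sets (euclid (node_dim S a)). \<forall>B\<in>sets (euclid (node_dim S b)).
        AE w in base S.
          real_cond_exp (base S) (node_sigma S C)
            (\<lambda>w. indicator A (node_rv S a w) * indicator B (node_rv S b w)) w =
          real_cond_exp (base S) (node_sigma S C) (\<lambda>w. indicator A (node_rv S a w)) w *
          real_cond_exp (base S) (node_sigma S C) (\<lambda>w. indicator B (node_rv S b w)) w)"

text \<open>
  The conditioning sets range over sets of endogenous variables. If exogenous variables were
  admitted as well, a non-root \<open>v\<close> with parent \<open>w\<close> would violate faithfulness in every model: given
  \<open>U\<^sub>w\<close> and the parents of \<open>w\<close>, the variable \<open>w\<close> is constant and thus independent of \<open>v\<close>, although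
  adjacent to it. Being required for fewer triples, this is a weaker condition on the model.
\<close>

definition faithful :: "('v, 'w) scm \<Rightarrow> bool" where
  "faithful S \<longleftrightarrow>
     (\<forall>a\<in>nodes_plus S. \<forall>b\<in>nodes_plus S. \<forall>C. a \<noteq> b \<and> C \<subseteq> Endo ` endo S - {a, b} \<and>
        cond_independent S a b C \<longrightarrow> d_separated (edges_plus S) a b C)"

section \<open>Causal exogenous variables and causal bias\<close>

text \<open>
  Throughout, \<open>X\<close> is the treatment, \<open>Y\<close> the outcome, \<open>Obs\<close> the set \<open>\<O>\<close> of observed variables and
  \<open>ob\<close> the realization of \<open>O\<close>.
\<close>

definition obs_nondesc :: "('v, 'w) scm \<Rightarrow> 'v \<Rightarrow> 'v set \<Rightarrow> 'v set" where
  "obs_nondesc S X Obs = Obs - descendants S X"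

definition causal_exo :: "('v, 'w) scm \<Rightarrow> 'v \<Rightarrow> 'v \<Rightarrow> 'v set \<Rightarrow> 'v set" where
  "causal_exo S X Y Obs = {v \<in> endo S. (Exo v, Endo Y) \<in> (edges_plus S)\<^sup>+ \<and>
     \<not> d_separated (edges_plus S) (Exo v) (Endo Y) (Endo ` ({X} \<union> obs_nondesc S X Obs))}"

text \<open>
  The scalar \<open>f\<^sub>Y\<close>, evaluated at \<open>x\<close> and at the part of \<open>ob\<close> that does not descend from \<open>X\<close>, as a
  function of the values \<open>u\<close> of \<open>U\<^sup>C\<close>; the outcome has dimension one, so its value is coordinate \<open>0\<close>.
  Exogenous variables outside the causal exogenous set do not influence the result.
\<close>

definition outcome_fn ::
  "('v, 'w) scm \<Rightarrow> 'v \<Rightarrow> 'v \<Rightarrow> 'v set \<Rightarrow> vec \<Rightarrow> ('v \<Rightarrow> vec) \<Rightarrow> ('v \<Rightarrow> vec) \<Rightarrow> real" where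
  "outcome_fn S X Y Obs x ob u = partial_eval S
     (\<lambda>v. if v = X then Some x else if v \<in> obs_nondesc S X Obs then Some (ob v) else None) Y u 0"

definition causal_exo_space :: "('v, 'w) scm \<Rightarrow> 'v \<Rightarrow> 'v \<Rightarrow> 'v set \<Rightarrow> ('v \<Rightarrow> vec) measure" where
  "causal_exo_space S X Y Obs = (\<Pi>\<^sub>M v\<in>causal_exo S X Y Obs. euclid (exo_dim S v))"

text \<open>
  \<open>p u x ob\<close> is a version of the joint density of \<open>U\<^sup>C\<close>, \<open>X\<close> and \<open>O\<close>. It is taken with respect to
  Lebesgue measure in \<open>u\<close> and \<open>x\<close>. Only the exogenous variables are assumed to be continuous, so each
  observed variable \<open>v\<close> has an arbitrary sigma-finite reference measure \<open>\<nu> v\<close> on its values, such as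
  Lebesgue measure for a continuous and a counting measure for a discrete variable.
\<close>

definition is_joint_density ::
  "('v, 'w) scm \<Rightarrow> 'v \<Rightarrow> 'v \<Rightarrow> 'v set \<Rightarrow> ('v \<Rightarrow> vec measure) \<Rightarrow>
   (('v \<Rightarrow> vec) \<Rightarrow> vec \<Rightarrow> ('v \<Rightarrow> vec) \<Rightarrow> real) \<Rightarrow> bool" where
  "is_joint_density S X Y Obs \<nu> p \<longleftrightarrow>
     (\<forall>v\<in>Obs. sigma_finite_measure (\<nu> v) \<and> sets (\<nu> v) = sets (euclid (endo_dim S v))) \<and>
     (\<forall>u x ob. 0 \<le> p u x ob) \<and>
     distributed (base S)
       (causal_exo_space S X Y Obs \<Otimes>\<^sub>M (euclid (endo_dim S X) \<Otimes>\<^sub>M (\<Pi>\<^sub>M v\<in>Obs. \<nu> v)))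
       (\<lambda>w. (\<lambda>v\<in>causal_exo S X Y Obs. exo S v w, endo_rv S X w, \<lambda>v\<in>Obs. endo_rv S v w))
       (\<lambda>(u, x, ob). ennreal (p u x ob))"

definition marginal_density where
  "marginal_density S X Y Obs p x ob = (\<integral>u. p u x ob \<partial>causal_exo_space S X Y Obs)"

definition cond_density where
  "cond_density S X Y Obs p u x ob = p u x ob / marginal_density S X Y Obs p x ob"

text \<open>The distribution of \<open>U\<^sup>C\<close> given \<open>X = x\<close> and \<open>O = ob\<close>.\<close>

definition posterior where
  "posterior S X Y Obs p x ob =
     density (causal_exo_space S X Y Obs) (\<lambda>u. ennreal (cond_density S X Y Obs p u x ob))"

definition cond_score where
  "cond_score S X Y Obs p x ob u =
     row_jacobian (endo_dim S X) (\<lambda>x'. ln (cond_density S X Y Obs p u x' ob)) x"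

definition joint_score where
  "joint_score S X p x ob u = row_jacobian (endo_dim S X) (\<lambda>x'. ln (p u x' ob)) x"

definition causal_bias where
  "causal_bias S X Y Obs p x ob = (\<lambda>k\<in>{..<endo_dim S X}.
     \<integral>u. outcome_fn S X Y Obs x ob u * cond_score S X Y Obs p x ob u k
       \<partial>posterior S X Y Obs p x ob)"

definition covariance :: "'a measure \<Rightarrow> ('a \<Rightarrow> real) \<Rightarrow> ('a \<Rightarrow> real) \<Rightarrow> real" where
  "covariance M f g =
     (\<integral>u. (f u - (\<integral>u'. f u' \<partial>M)) * (g u - (\<integral>u'. g u' \<partial>M)) \<partial>M)"

text \<open>The row vector of covariances of a scalar with the \<open>n\<close> components of a row vector.\<close>

definition row_covariance :: "nat \<Rightarrow> 'a measure \<Rightarrow> ('a \<Rightarrow> real) \<Rightarrow> ('a \<Rightarrow> vec) \<Rightarrow> vec" where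
  "row_covariance n M f g = (\<lambda>k\<in>{..<n}. covariance M f (\<lambda>u. g u k))"

end

theory Submission
  imports Defs
begin

text \<open>
  Write \<open>m\<close> for the marginal density of \<open>(X, O)\<close>. The conditional score is the joint score minus
  \<open>c = \<nabla> m / m\<close>, which does not depend on \<open>U\<^sup>C\<close>; so it remains to see that \<open>c\<close> is the posterior mean of
  the joint score. There the density \<open>p / m\<close> cancels the denominator of \<open>\<nabla> p / p\<close>, leaving
  \<open>\<nabla> p / m\<close>, whose integral is \<open>c\<close> by the interchange assumption. The cancellation is also valid
  where \<open>p = 0\<close>: as \<open>p \<ge> 0\<close>, such a point is a minimum of \<open>p\<close>, so that \<open>\<nabla> p = 0\<close> there.
\<close>

lemma space_euclid: "space (euclid n) = extensional {..<n}"
  by (auto simp: euclid_def space_PiM PiE_def)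

text \<open>Along the line \<open>x(k := t)\<close> the Euclidean distance to \<open>x\<close> is
  \<open>\<bar>t - x k\<bar>\<close> and the linear form given by \<open>g\<close> reduces to its
  \<open>k\<close>-th term, so the Frechet estimate becomes the one-variable one. The line stays in
  the space because \<open>k < n\<close>.\<close>

lemma vec_differentiable_partial:
  assumes diff: "vec_differentiable n h x" and x: "x \<in> space (euclid n)" and k: "k < n"
  shows "((\<lambda>t. h (x(k := t))) has_real_derivative row_jacobian n h x k) (at (x k))"
proof -
  from diff obtain g where g: "\<And>\<epsilon>. \<epsilon> > 0 \<Longrightarrow> \<exists>\<delta>>0. \<forall>y\<in>space (euclid n).
        L2_set (\<lambda>k. y k - x k) {..<n} < \<delta> \<longrightarrow>
        \<bar>h y - h x - (\<Sum>k<n. g k * (y k - x k))\<bar> \<le> \<epsilon> * L2_set (\<lambda>k. y k - x k) {..<n}"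
    unfolding vec_differentiable_def by blast
  have norm: "L2_set (\<lambda>i. (x(k := t)) i - x i) {..<n} = \<bar>t - x k\<bar>" for t
  proof -
    have "(\<Sum>i<n. ((x(k := t)) i - x i)\<^sup>2) = (\<Sum>i<n. if i = k then (t - x k)\<^sup>2 else 0)"
      by (intro sum.cong) auto
    then show ?thesis using k by (simp add: L2_set_def)
  qed
  have lin: "(\<Sum>i<n. g i * ((x(k := t)) i - x i)) = g k * (t - x k)" for t
  proof -
    have "(\<Sum>i<n. g i * ((x(k := t)) i - x i)) = (\<Sum>i<n. if i = k then g k * (t - x k) else 0)"
      by (intro sum.cong) auto
    then show ?thesis using k by simp
  qed
  have dom: "x(k := t) \<in> space (euclid n)" for t
    using x k by (auto simp: space_euclid extensional_def)
  have "((\<lambda>t. h (x(k := t))) has_derivative (\<lambda>s. g k * s)) (at (x k))"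
    unfolding has_derivative_within_alt
  proof (intro conjI allI impI)
    show "bounded_linear (\<lambda>s. g k * s)" by (rule bounded_linear_mult_right)
    fix e :: real assume "0 < e"
    from g[OF this] obtain \<delta> where "\<delta> > 0" and \<delta>: "\<And>y. y \<in> space (euclid n) \<Longrightarrow>
        L2_set (\<lambda>k. y k - x k) {..<n} < \<delta> \<Longrightarrow>
        \<bar>h y - h x - (\<Sum>k<n. g k * (y k - x k))\<bar> \<le> e * L2_set (\<lambda>k. y k - x k) {..<n}"
      by blast
    \<comment> \<open>\<open>norm\<close> and \<open>lin\<close> are applied before full
      simplification, which would split the updates \<open>(x(k := t)) i\<close> into cases and hide
      their left-hand sides.\<close>
    have "\<forall>t\<in>UNIV. norm (t - x k) < \<delta> \<longrightarrow>
        norm (h (x(k := t)) - h (x(k := x k)) - g k * (t - x k)) \<le> e * norm (t - x k)"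
      using \<delta>[OF dom] by (simp only: norm lin) simp
    with \<open>\<delta> > 0\<close> show "\<exists>d>0. \<forall>t\<in>UNIV. norm (t - x k) < d \<longrightarrow>
        norm (h (x(k := t)) - h (x(k := x k)) - g k * (t - x k)) \<le> e * norm (t - x k)"
      by blast
  qed
  then have "((\<lambda>t. h (x(k := t))) has_real_derivative g k) (at (x k))"
    by (simp add: has_field_derivative_def)
  with k show ?thesis by (simp add: row_jacobian_def DERIV_imp_deriv)
qed

lemma row_jacobian_eqI:
  assumes "((\<lambda>t. h (x(k := t))) has_real_derivative d) (at (x k))" and "k < n"
  shows "row_jacobian n h x k = d"
  using assms by (simp add: row_jacobian_def DERIV_imp_deriv)

lemma row_jacobian_ln:
  assumes "vec_differentiable n h x" "x \<in> space (euclid n)" "k < n" "0 < h x"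
  shows "row_jacobian n (\<lambda>x'. ln (h x')) x k = row_jacobian n h x k / h x"
  using assms
  by (auto intro!: row_jacobian_eqI derivative_eq_intros vec_differentiable_partial)

text \<open>The quotient is differentiated under the logarithm directly, without splitting the
  logarithm near \<open>x\<close>, so positivity at \<open>x\<close> itself suffices. In the
  application the first term becomes the joint score and the second is constant in
  \<open>u\<close>.\<close>

lemma row_jacobian_ln_divide:
  assumes diff: "vec_differentiable n h x" "vec_differentiable n m x"
    and x: "x \<in> space (euclid n)" and k: "k < n" and pos: "0 < h x" "0 < m x"
  shows "row_jacobian n (\<lambda>x'. ln (h x' / m x')) x k =
    row_jacobian n (\<lambda>x'. ln (h x')) x k - row_jacobian n m x k / m x"
proof -
  have "row_jacobian n (\<lambda>x'. ln (h x' / m x')) x k =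
      row_jacobian n h x k / h x - row_jacobian n m x k / m x"
    using pos k
    by (intro row_jacobian_eqI)
      (auto intro!: derivative_eq_intros vec_differentiable_partial[OF diff(1) x k]
        vec_differentiable_partial[OF diff(2) x k] simp: field_simps)
  then show ?thesis by (simp add: row_jacobian_ln[OF diff(1) x k pos(1)])
qed

lemma row_jacobian_nonneg_zero:
  assumes "vec_differentiable n h x" "x \<in> space (euclid n)" "k < n"
    and "\<And>y. 0 \<le> h y" "h x = 0"
  shows "row_jacobian n h x k = 0"
  \<comment> \<open>The minimum is global, so the radius 1 of the neighbourhood is
    arbitrary.\<close>
  by (rule DERIV_local_min[OF vec_differentiable_partial[OF assms(1-3)], of 1])
    (use assms(4,5) in auto)

text \<open>Expanding the product gives four terms; total mass one evaluates the constant term.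
  Integrability of \<open>f u * g u\<close> does not follow from that of the factors.\<close>

lemma (in prob_space) covariance_eq:
  assumes "integrable M f" "integrable M g" "integrable M (\<lambda>u. f u * g u)"
  shows "covariance M f g = expectation (\<lambda>u. f u * g u) - expectation f * expectation g"
proof -
  have "covariance M f g = expectation (\<lambda>u. f u * g u - expectation g * f u
      - expectation f * g u + expectation f * expectation g)"
    unfolding covariance_def by (intro Bochner_Integration.integral_cong) (auto simp: algebra_simps)
  also have "\<dots> = expectation (\<lambda>u. f u * g u) - expectation f * expectation g"
    using assms by (simp add: prob_space)
  finally show ?thesis .
qed

lemma borel_measurable_joint_density:
  assumes joint: "is_joint_density S X Y Obs \<nu> p"
    and "x \<in> space (euclid (endo_dim S X))" "ob \<in> space (\<Pi>\<^sub>M v\<in>Obs. \<nu> v)"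
  shows "(\<lambda>u. p u x ob) \<in> borel_measurable (causal_exo_space S X Y Obs)"
proof -
  let ?U = "causal_exo_space S X Y Obs"
  have dens: "(\<lambda>(u, x, ob). ennreal (p u x ob)) \<in>
      borel_measurable (?U \<Otimes>\<^sub>M (euclid (endo_dim S X) \<Otimes>\<^sub>M (\<Pi>\<^sub>M v\<in>Obs. \<nu> v)))"
    using joint unfolding is_joint_density_def by (auto dest: distributed_borel_measurable)
  have sect: "(\<lambda>u. (u, x, ob)) \<in>
      measurable ?U (?U \<Otimes>\<^sub>M (euclid (endo_dim S X) \<Otimes>\<^sub>M (\<Pi>\<^sub>M v\<in>Obs. \<nu> v)))"
    using assms(2,3) by (intro measurable_Pair measurable_ident measurable_const) auto
  have "(\<lambda>u. ennreal (p u x ob)) \<in> borel_measurable ?U"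
    using measurable_compose[OF sect dens] by simp
  \<comment> \<open>The joint density is known to be measurable only after coercion by
    \<open>ennreal\<close>; \<open>enn2real\<close> undoes this because \<open>p\<close> is
    nonnegative.\<close>
  then have "(\<lambda>u. enn2real (ennreal (p u x ob))) \<in> borel_measurable ?U"
    by measurable
  then show ?thesis
    using joint by (simp add: is_joint_density_def)
qed

theorem theorem2p9:
  fixes S :: "('v, 'w) scm" and X Y :: 'v and Obs :: "'v set"
    and \<nu> :: "'v \<Rightarrow> vec measure"
    and p :: "('v \<Rightarrow> vec) \<Rightarrow> vec \<Rightarrow> ('v \<Rightarrow> vec) \<Rightarrow> real"
    and x :: vec and ob :: "'v \<Rightarrow> vec"
  assumes scm: "is_scm S"
    and vars: "X \<in> endo S" "Y \<in> endo S" "X \<noteq> Y" "endo_dim S Y = 1" "Obs \<subseteq> endo S - {X, Y}"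
    and pos: "\<forall>v\<in>endo S. \<forall>u\<in>exo_range S v. 0 < exo_density S v u"
    and faithful: "faithful S"
    and joint: "is_joint_density S X Y Obs \<nu> p"
    and point: "x \<in> space (euclid (endo_dim S X))" "ob \<in> space (\<Pi>\<^sub>M v\<in>Obs. \<nu> v)"
      "0 < marginal_density S X Y Obs p x ob"
    and diff_f: "AE u in causal_exo_space S X Y Obs.
      vec_differentiable (endo_dim S X) (\<lambda>x'. outcome_fn S X Y Obs x' ob u) x"
    and diff_p: "AE u in causal_exo_space S X Y Obs.
      vec_differentiable (endo_dim S X) (\<lambda>x'. p u x' ob) x"
    and diff_marginal:
      "vec_differentiable (endo_dim S X) (\<lambda>x'. marginal_density S X Y Obs p x' ob) x"
    and interchange: "\<forall>k<endo_dim S X.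
      integrable (causal_exo_space S X Y Obs)
        (\<lambda>u. row_jacobian (endo_dim S X) (\<lambda>x'. p u x' ob) x k) \<and>
      row_jacobian (endo_dim S X) (\<lambda>x'. marginal_density S X Y Obs p x' ob) x k =
        (\<integral>u. row_jacobian (endo_dim S X) (\<lambda>x'. p u x' ob) x k \<partial>causal_exo_space S X Y Obs)"
    and expectations: "integrable (posterior S X Y Obs p x ob) (outcome_fn S X Y Obs x ob)"
      "\<forall>k<endo_dim S X. integrable (posterior S X Y Obs p x ob)
        (\<lambda>u. outcome_fn S X Y Obs x ob u * cond_score S X Y Obs p x ob u k)"
      "\<forall>k<endo_dim S X. integrable (posterior S X Y Obs p x ob)
        (\<lambda>u. joint_score S X p x ob u k)"
      "\<forall>k<endo_dim S X. integrable (posterior S X Y Obs p x ob)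
        (\<lambda>u. outcome_fn S X Y Obs x ob u * joint_score S X p x ob u k)"
  shows "causal_bias S X Y Obs p x ob =
    row_covariance (endo_dim S X) (posterior S X Y Obs p x ob)
      (outcome_fn S X Y Obs x ob) (joint_score S X p x ob)"
proof -
  define U where "U = causal_exo_space S X Y Obs"
  define P where "P = posterior S X Y Obs p x ob"
  define n where "n = endo_dim S X"
  define m where "m = (\<lambda>x'. marginal_density S X Y Obs p x' ob)"
  define f where "f = outcome_fn S X Y Obs x ob"
  define js where "js = joint_score S X p x ob"
  define dp where "dp = (\<lambda>u. row_jacobian n (\<lambda>x'. p u x' ob) x)"
  define c where "c = (\<lambda>k. row_jacobian n m x k / m x)"
  note x = point(1)[folded n_def]
  have p_nonneg: "0 \<le> p u x' ob" for u x'
    using joint by (simp add: is_joint_density_def)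
  have m_pos: "0 < m x" and m_diff: "vec_differentiable n m x"
    using point(3) diff_marginal by (simp_all add: m_def n_def)
  have m_eq: "m x = (\<integral>u. p u x ob \<partial>U)"
    by (simp add: m_def marginal_density_def U_def)
  have p_diff: "AE u in U. vec_differentiable n (\<lambda>x'. p u x' ob) x"
    using diff_p unfolding U_def n_def .
  have P_eq: "P = density U (\<lambda>u. ennreal (p u x ob / m x))"
    by (simp add: P_def posterior_def cond_density_def U_def m_def)
  have p_meas [measurable]: "(\<lambda>u. p u x ob) \<in> borel_measurable U"
    using borel_measurable_joint_density[OF joint point(1,2)] by (simp add: U_def)
  \<comment> \<open>The Bochner integral of a non-integrable function is 0 by default, so a positive
    marginal density forces integrability.\<close>
  have p_int: "integrable U (\<lambda>u. p u x ob)"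
    using m_pos m_eq not_integrable_integral_eq by fastforce
  interpret P: prob_space P
  proof
    have "emeasure P (space P) = (\<integral>\<^sup>+u. ennreal (p u x ob / m x) \<partial>U)"
      by (simp add: P_eq emeasure_density cong: nn_integral_cong)
    also have "\<dots> = ennreal (\<integral>u. p u x ob / m x \<partial>U)"
      using p_int p_nonneg m_pos by (intro nn_integral_eq_integral) auto
    also have "\<dots> = 1" using m_pos by (simp add: m_eq)
    finally show "emeasure P (space P) = 1" .
  qed
  \<comment> \<open>The posterior has a density that is positive only where \<open>p\<close> is, so
    it ignores the zeros of \<open>p\<close>; it also inherits the null sets of
    \<open>U\<close>.\<close>
  have AE_P: "AE u in P. 0 < p u x ob \<and> vec_differentiable n (\<lambda>x'. p u x' ob) x"
    unfolding P_eq using p_diff m_pos by (subst AE_density) (auto simp: zero_less_divide_iff)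

  have mean_js: "P.expectation (\<lambda>u. js u k) = c k" if k: "k < n" for k
  proof -
    have js_int: "integrable P (\<lambda>u. js u k)"
      using expectations(3) k by (simp add: P_def js_def n_def)
    \<comment> \<open>Passing to a density keeps the sigma-algebra, so measurability carries over
      from \<open>P\<close> to \<open>U\<close>.\<close>
    then have [measurable]: "(\<lambda>u. js u k) \<in> borel_measurable U"
      by (auto simp: P_eq dest: borel_measurable_integrable)
    have dp_int: "integrable U (\<lambda>u. dp u k)"
      and dp_eq: "row_jacobian n m x k = (\<integral>u. dp u k \<partial>U)"
      using interchange k by (simp_all add: U_def dp_def n_def m_def)
    from dp_int have [measurable]: "(\<lambda>u. dp u k) \<in> borel_measurable U"
      by (rule borel_measurable_integrable)
    have "P.expectation (\<lambda>u. js u k) = (\<integral>u. p u x ob / m x * js u k \<partial>U)"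
      unfolding P_eq using p_nonneg m_pos by (subst integral_density) auto
    also have "\<dots> = (\<integral>u. dp u k / m x \<partial>U)"
    proof (intro integral_cong_AE)
      show "AE u in U. p u x ob / m x * js u k = dp u k / m x"
        using p_diff
      proof eventually_elim
        case (elim u)
        show ?case
        \<comment> \<open>The integrals are now over \<open>U\<close>, so zeros of \<open>p\<close>
          count. There the factor \<open>p u x ob\<close> annihilates whatever value
          \<open>deriv\<close> assigns to the score.\<close>
        proof (cases "p u x ob = 0")
          case True
          then show ?thesis
            using row_jacobian_nonneg_zero[OF elim x k p_nonneg] by (simp add: dp_def)
        next
          case False
          with p_nonneg[of u x] have "0 < p u x ob" by simp
          with row_jacobian_ln[OF elim x k] show ?thesis
            by (simp add: js_def joint_score_def dp_def n_def)
        qed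
      qed
    qed measurable
    also have "\<dots> = c k" by (simp add: c_def dp_eq)
    finally show ?thesis .
  qed

  have "causal_bias S X Y Obs p x ob k = row_covariance n P f js k" if k: "k < n" for k
  proof -
    have ints: "integrable P f" "integrable P (\<lambda>u. js u k)" "integrable P (\<lambda>u. f u * js u k)"
      "integrable P (\<lambda>u. f u * cond_score S X Y Obs p x ob u k)"
      using expectations k by (simp_all add: P_def js_def n_def f_def)
    have "causal_bias S X Y Obs p x ob k =
        P.expectation (\<lambda>u. f u * cond_score S X Y Obs p x ob u k)"
      using k by (simp add: causal_bias_def n_def f_def P_def)
    \<comment> \<open>Both integrals are against \<open>P\<close>, so the identity of the scores is
      needed only where \<open>p\<close> is positive and differentiable.\<close>
    also have "\<dots> = P.expectation (\<lambda>u. f u * js u k - c k * f u)"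
    proof (intro integral_cong_AE)
      show "AE u in P. f u * cond_score S X Y Obs p x ob u k = f u * js u k - c k * f u"
        using AE_P
      proof eventually_elim
        case (elim u)
        then have "cond_score S X Y Obs p x ob u k = js u k - c k"
          using row_jacobian_ln_divide[OF _ m_diff x k _ m_pos, of "\<lambda>x'. p u x' ob"]
          by (simp add: cond_score_def cond_density_def js_def joint_score_def c_def n_def m_def)
        then show ?case by (simp only: right_diff_distrib mult.commute)
      qed
    qed (use ints in \<open>auto intro!: borel_measurable_integrable\<close>)
    also have "\<dots> = P.expectation (\<lambda>u. f u * js u k) - P.expectation f * c k"
      using ints by simp
    \<comment> \<open>By \<open>mean_js\<close>, \<open>c k\<close> is the posterior mean of the
      joint score, which completes the product formula for the covariance.\<close>
    also have "\<dots> = row_covariance n P f js k"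
      using ints k by (simp add: row_covariance_def P.covariance_eq mean_js)
    finally show ?thesis .
  qed
  then have "causal_bias S X Y Obs p x ob = row_covariance n P f js"
    \<comment> \<open>From index \<open>n\<close> on, both row vectors are \<open>undefined\<close>
      by restriction.\<close>
    by (auto simp: fun_eq_iff causal_bias_def row_covariance_def n_def restrict_def)
  then show ?thesis by (simp add: n_def P_def f_def js_def)
qed

end
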